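(* Let $p,q,r$ be distinct primes. Suppose $S$ is a numerical semigroup which is cyclotomic of depth $pqr$ and height $1$. Then $S$ is one of $\langle pr,q\rangle$, $\langle qp,r\rangle$, $\langle rq,p\rangle$.
   Context: A numerical semigroup is a submonoid $S$ of $(\mathbb N,+)$ with $\mathbb N\setminus S$ finite; $\langle a,b\rangle$ denotes the submonoid generated by $a,b$. $\mathrm P_S(x)=(1-x)\sum_{s\in S}x^s$. $S$ is cyclotomic if $\mathrm P_S$ has all complex roots in the closed unit disc. $S$ is cyclotomic of depth $d$ and height $h$ if $\mathrm P_S(x)\mid (x^d-1)^h$ with $d,h$ chosen minimally, that is, $\mathrm P_S(x)$ does not divide $(x^n-1)^{h-1}$ for any $n$, and does not divide $(x^{d'}-1)^h$ for any divisor $d'<d$ of $d$. *)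

theory Defs
  imports "HOL-Computational_Algebra.Computational_Algebra"
begin

definition numerical_semigroup :: "nat set \<Rightarrow> bool" where
  "numerical_semigroup S \<longleftrightarrow>
     0 \<in> S \<and> (\<forall>a\<in>S. \<forall>b\<in>S. a + b \<in> S) \<and> finite (UNIV - S)"

definition gen2 :: "nat \<Rightarrow> nat \<Rightarrow> nat set" where
  "gen2 a b = {i * a + j * b | i j. True}"

definition semigroup_fps :: "nat set \<Rightarrow> int fps" where
  "semigroup_fps S = Abs_fps (\<lambda>n. if n \<in> S then 1 else 0)"

text \<open>The semigroup polynomial P_S(x) = (1 - x) * sum_{s in S} x^s
  (a polynomial when the complement of S is finite).\<close>
definition semigroup_poly :: "nat set \<Rightarrow> int poly" where
  "semigroup_poly S = (THE p. fps_of_poly p = (1 - fps_X) * semigroup_fps S)"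

definition cyclotomic_ns :: "nat set \<Rightarrow> bool" where
  "cyclotomic_ns S \<longleftrightarrow> numerical_semigroup S \<and>
     (\<forall>z::complex. poly (map_poly of_int (semigroup_poly S)) z = 0 \<longrightarrow> norm z \<le> 1)"

definition xpow_minus_one :: "nat \<Rightarrow> int poly" where
  "xpow_minus_one n = monom 1 n - 1"

definition cyclotomic_depth_height :: "nat set \<Rightarrow> nat \<Rightarrow> nat \<Rightarrow> bool" where
  "cyclotomic_depth_height S d h \<longleftrightarrow>
     cyclotomic_ns S \<and> 0 < d \<and>
     semigroup_poly S dvd (xpow_minus_one d) ^ h \<and>
     (\<forall>n>0. \<not> semigroup_poly S dvd (xpow_minus_one n) ^ (h - 1)) \<and>
     (\<forall>d'. d' dvd d \<and> d' < d \<longrightarrow> \<not> semigroup_poly S dvd (xpow_minus_one d') ^ h)"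

end

theory Submission
  imports Defs
begin

text \<open>A factor over \<open>\<int>\<close> of \<open>x\<^sup>N - 1\<close>, \<open>N = pqr\<close>, is a product of distinct cyclotomic polynomials
  \<open>\<Phi>\<^sub>d\<close> with \<open>d\<close> dividing \<open>N\<close>, because its root set is closed under \<open>\<zeta> \<mapsto> \<zeta>\<^sup>k\<close> for \<open>k\<close> coprime to
  \<open>N\<close>. Since \<open>P\<^sub>S(1) = 1\<close>, only \<open>d \<in> {pq, pr, qr, pqr}\<close> can occur. The coefficient of \<open>x\<close> in \<open>P\<^sub>S\<close> is
  \<open>-1\<close>, while it is \<open>-1\<close> in \<open>\<Phi>\<^sub>p\<^sub>q\<close> and \<open>1\<close> in \<open>\<Phi>\<^sub>p\<^sub>q\<^sub>r\<close>, so either \<open>P\<^sub>S\<close> is a single \<open>\<Phi>\<close> of a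
  product of two primes, which the depth excludes, or \<open>P\<^sub>S\<close> is \<open>\<Phi>\<^sub>p\<^sub>q\<^sub>r\<close> times two of these. The latter
  products are exactly the polynomials of the three semigroups.\<close>

subsection \<open>Roots of integer factors of $x^n - 1$\<close>

abbreviation cpoly :: "int poly \<Rightarrow> complex poly" where
  "cpoly \<equiv> map_poly of_int"

lemma cpoly_mult: "cpoly (f * g) = cpoly f * cpoly g"
  by (rule poly_eqI) (simp add: coeff_map_poly coeff_mult)

lemma cpoly_add: "cpoly (f + g) = cpoly f + cpoly g"
  by (rule poly_eqI) (simp add: coeff_map_poly)

lemma cpoly_diff: "cpoly (f - g) = cpoly f - cpoly g"
  by (rule poly_eqI) (simp add: coeff_map_poly)

lemma cpoly_1: "cpoly 1 = 1"
  by (simp add: map_poly_1')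

lemma cpoly_power: "cpoly (f ^ n) = cpoly f ^ n"
  by (induction n) (simp_all add: cpoly_1 cpoly_mult)

lemma cpoly_of_nat: "cpoly (of_nat n) = of_nat n"
  by (simp add: of_nat_poly map_poly_pCons)

lemma cpoly_pderiv: "cpoly (pderiv f) = pderiv (cpoly f)"
  by (rule poly_eqI) (simp add: coeff_map_poly coeff_pderiv)

lemma cpoly_eq_iff: "cpoly f = cpoly g \<longleftrightarrow> f = g"
  by (simp add: poly_eq_iff coeff_map_poly)

lemma cpoly_xpow: "cpoly (xpow_minus_one n) = monom 1 n - 1"
  by (simp add: xpow_minus_one_def cpoly_diff cpoly_1 map_poly_monom)

lemma poly_cpoly_of_int: "poly (cpoly f) (of_int x) = of_int (poly f x)"
  by (induction f) (simp_all add: map_poly_pCons)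

lemma poly_cpoly_pcompose_monom:
  "poly (cpoly (f \<circ>\<^sub>p monom 1 n)) z = poly (cpoly f) (z ^ n)"
  by (induction f) (simp_all add: pcompose_pCons map_poly_pCons cpoly_add cpoly_mult map_poly_monom poly_monom)

text \<open>A \<open>\<rat>\<close>-linear retraction of \<open>\<complex>\<close> onto \<open>\<rat>\<close> replaces the closure properties of algebraic
  integers: it maps \<open>\<int>[\<zeta>]\<close> into \<open>(1/M)\<int>\<close> for a fixed \<open>M\<close>, so powers of a rational number lying in
  \<open>\<int>[\<zeta>]\<close> have bounded denominators.\<close>

lemma rational_functional_exists:
  obtains \<phi> :: "complex \<Rightarrow> rat" where
    "\<And>x y. \<phi> (x + y) = \<phi> x + \<phi> y"
    "\<And>c x. \<phi> (of_int c * x) = of_int c * \<phi> x"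
    "\<And>c. \<phi> (of_rat c) = c"
proof -
  interpret vector_space_pair "\<lambda>(c::rat) (z::complex). of_rat c * z" "\<lambda>(c::rat) (z::rat). c * z"
    by unfold_locales (simp_all add: algebra_simps of_rat_add of_rat_mult)
  have "vs1.independent {1}"
    by (simp add: vs1.dependent_single)
  then obtain \<phi> where \<phi>: "Vector_Spaces.linear (\<lambda>c z. of_rat c * z) (*) \<phi>" "\<phi> (1::complex) = (1::rat)"
    using linear_independent_extend[of "{1}" "\<lambda>_. 1"] by auto
  have sc: "\<phi> (of_rat c * x) = c * \<phi> x" for c x
    using \<phi>(1) by (simp add: Vector_Spaces.linear_iff)
  show ?thesis
  proof
    show "\<phi> (x + y) = \<phi> x + \<phi> y" for x y
      using \<phi>(1) by (simp add: Vector_Spaces.linear_iff)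
    show "\<phi> (of_int c * x) = of_int c * \<phi> x" for c x
      using sc[of "of_int c"] by simp
    show "\<phi> (of_rat c) = c" for c
      using sc[of c 1] \<phi>(2) by simp
  qed
qed

lemma rat_common_denominator:
  fixes f :: "nat \<Rightarrow> rat"
  obtains M :: int where "M > 0" "\<And>i. i < n \<Longrightarrow> of_int M * f i \<in> \<int>"
proof
  define d where "d i = snd (quotient_of (f i))" for i
  show "(\<Prod>i<n. d i) > 0"
    by (intro prod_pos) (auto simp: d_def quotient_of_denom_pos')
  show "of_int (\<Prod>i<n. d i) * f i \<in> \<int>" if "i < n" for i
  proof -
    have "d i dvd (\<Prod>i<n. d i)"
      using that by (intro dvd_prodI) auto
    then obtain k where k: "(\<Prod>i<n. d i) = d i * k" ..
    have "f i = of_int (fst (quotient_of (f i))) / of_int (d i)"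
      unfolding d_def by (metis quotient_of_div surjective_pairing)
    moreover have "d i \<noteq> 0"
      unfolding d_def using quotient_of_denom_pos'[of "f i"] by simp
    ultimately have "of_int (d i) * f i = of_int (fst (quotient_of (f i)))"
      by (metis nonzero_mult_div_cancel_left of_int_eq_0_iff times_divide_eq_right)
    then have "of_int (\<Prod>i<n. d i) * f i = of_int (k * fst (quotient_of (f i)))"
      unfolding k by (simp add: mult_ac)
    then show ?thesis
      using Ints_of_int by metis
  qed
qed

text \<open>Otherwise \<open>l ^ k\<close>, being coprime to \<open>m ^ k\<close>, divides the fixed
  nonzero \<open>M\<close> for every \<open>k\<close>, which fails by size for large
  \<open>k\<close>.\<close>

lemma prime_dvd_if_dvd_all_powers:
  fixes l :: nat and m M :: int
  assumes "prime l" "M \<noteq> 0" "\<And>k. int l ^ k dvd m ^ k * M"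
  shows "int l dvd m"
proof (rule ccontr)
  assume "\<not> int l dvd m"
  then have "coprime (int l) m"
    using assms(1) by (intro prime_imp_coprime) auto
  then have dv: "int l ^ k dvd M" for k
    using assms(3)[of k] coprime_dvd_mult_right_iff[of "int l ^ k" "m ^ k" M] by simp
  have "int l ^ k \<le> \<bar>M\<bar>" for k
    using dvd_imp_le_int[OF assms(2) dv[of k]] by simp
  moreover have "\<bar>M\<bar> < 2 ^ nat \<bar>M\<bar>"
    using less_exp[of "nat \<bar>M\<bar>"] by (metis abs_ge_zero int_nat_eq of_nat_less_numeral_power_cancel_iff)
  moreover have "(2::int) ^ nat \<bar>M\<bar> \<le> int l ^ nat \<bar>M\<bar>"
    using prime_ge_2_nat[OF assms(1)] by (intro power_mono) auto
  ultimately show False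
    by (meson linorder_not_less order_less_le_trans)
qed

text \<open>This says that \<open>l\<close> Z[\<zeta>] meets Z in \<open>l\<close> Z. The powers of
  \<open>m / l\<close> are values of the \<open>W ^ k\<close> at \<zeta>, so one \<open>M\<close>
  clears all their denominators.\<close>

lemma dvd_of_root_of_unity_eval:
  fixes l n :: nat and m :: int and \<zeta> :: complex and W :: "int poly"
  assumes "prime l" "n > 0" "\<zeta> ^ n = 1" and W: "of_int m = of_nat l * poly (cpoly W) \<zeta>"
  shows "int l dvd m"
proof -
  obtain \<phi> :: "complex \<Rightarrow> rat" where
    add: "\<And>x y. \<phi> (x + y) = \<phi> x + \<phi> y" and
    sc: "\<And>c x. \<phi> (of_int c * x) = of_int c * \<phi> x" and
    id: "\<And>c. \<phi> (of_rat c) = c"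
    using rational_functional_exists by blast
  have \<phi>sum: "\<phi> (\<Sum>i\<in>I. of_int (c i) * x i) = (\<Sum>i\<in>I. of_int (c i) * \<phi> (x i))"
    if "finite I" for I and c :: "nat \<Rightarrow> int" and x
    using that by induction (use id[of 0] in \<open>simp_all add: add sc\<close>)
  obtain M :: int where M: "M > 0" "\<And>i. i < n \<Longrightarrow> of_int M * \<phi> (\<zeta> ^ i) \<in> \<int>"
    using rat_common_denominator[of n "\<lambda>i. \<phi> (\<zeta> ^ i)"] by blast
  \<comment> \<open>Exponents reduce modulo \<open>n\<close>, so a common denominator of
    \<open>n\<close> values of \<phi> serves all of Z[\<zeta>].\<close>
  have red: "\<zeta> ^ i = \<zeta> ^ (i mod n)" for i
  proof -
    have "\<zeta> ^ i = \<zeta> ^ (n * (i div n) + i mod n)" by simp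
    also have "\<dots> = \<zeta> ^ (i mod n)"
      unfolding power_add power_mult assms(3) by simp
    finally show ?thesis .
  qed
  have int: "of_int M * \<phi> (poly (cpoly V) \<zeta>) \<in> \<int>" for V
  proof -
    have "poly (cpoly V) \<zeta> = (\<Sum>i\<le>degree (cpoly V). of_int (coeff V i) * \<zeta> ^ i)"
      by (simp add: poly_altdef coeff_map_poly)
    then have "of_int M * \<phi> (poly (cpoly V) \<zeta>) =
        (\<Sum>i\<le>degree (cpoly V). of_int (coeff V i) * (of_int M * \<phi> (\<zeta> ^ i)))"
      by (simp only: \<phi>sum[OF finite_atMost] sum_distrib_left mult.left_commute)
    also have "\<dots> \<in> \<int>"
    proof (rule Ints_sum, rule Ints_mult[OF Ints_of_int])
      show "of_int M * \<phi> (\<zeta> ^ i) \<in> \<int>" for i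
        by (subst red, rule M(2)) (use assms(2) in simp)
    qed
    finally show ?thesis .
  qed
  have "int l ^ k dvd m ^ k * M" for k
  proof -
    have l0: "of_nat l \<noteq> (0::rat)" "of_nat l \<noteq> (0::complex)"
      using prime_gt_0_nat[OF assms(1)] by auto
    \<comment> \<open>This value is rational, so \<phi> returns it unchanged and \<open>int\<close>
      bounds the denominator of the number itself.\<close>
    have "poly (cpoly (W ^ k)) \<zeta> = of_rat ((of_int m / of_nat l) ^ k)"
      using W l0 by (simp add: cpoly_power of_rat_power of_rat_divide)
    then have "of_int M * (of_int m / of_nat l) ^ k \<in> (\<int> :: rat set)"
      using int[of "W ^ k"] by (simp only: id)
    then obtain c where "of_int M * (of_int m / of_nat l) ^ k = (of_int c :: rat)"
      by (auto elim: Ints_cases)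
    then have "of_int M * of_int m ^ k = (of_int c :: rat) * of_nat l ^ k"
      using l0 by (simp add: power_divide field_simps)
    then have "(of_int (m ^ k * M) :: rat) = of_int (int l ^ k * c)"
      by (simp add: mult_ac)
    then have "m ^ k * M = int l ^ k * c"
      by (simp only: of_int_eq_iff)
    then show ?thesis by simp
  qed
  then show ?thesis
    using prime_dvd_if_dvd_all_powers[OF assms(1), of M m] M(1) by auto
qed

section \<open>Frobenius congruences modulo a prime\<close>

lemma dvd_freshman:
  fixes a b :: "'a :: comm_ring_1"
  assumes "prime l"
  shows "of_nat l dvd (a + b) ^ l - (a ^ l + b ^ l)"
proof -
  have l: "l > 0" using assms prime_gt_0_nat by blast
  have "(a + b) ^ l = (\<Sum>k\<le>l. of_nat (l choose k) * a ^ k * b ^ (l - k))"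
    by (rule binomial_ring)
  also have "{..l} = insert 0 (insert l {0<..<l})"
    using l by auto
  finally have "(a + b) ^ l - (a ^ l + b ^ l) =
      (\<Sum>k\<in>{0<..<l}. of_nat (l choose k) * a ^ k * b ^ (l - k))"
    using l by simp
  also have "of_nat l dvd \<dots>"
  proof (intro dvd_sum dvd_mult2)
    fix k assume "k \<in> {0<..<l}"
    then have "l dvd l choose k"
      using assms by (intro dvd_choose_prime) auto
    then show "(of_nat l :: 'a) dvd of_nat (l choose k)"
      by (metis dvdE dvdI of_nat_mult)
  qed
  finally show ?thesis .
qed

lemma int_prime_dvd_power_diff:
  fixes a :: int
  assumes "prime l"
  shows "int l dvd a ^ l - a"
proof -
  have l: "l > 0" using assms prime_gt_0_nat by blast
  have nat: "int l dvd int k ^ l - int k" for k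
  proof (induction k)
    case (Suc k)
    have "int l dvd (int k + 1) ^ l - (int k ^ l + 1 ^ l)"
      using dvd_freshman[OF assms, of "int k" 1] by simp
    from dvd_add[OF this Suc] show ?case by (simp add: algebra_simps)
  qed (use l in \<open>simp add: power_0_left\<close>)
  \<comment> \<open>The induction covers natural numbers only; a possibly negative \<open>a\<close>
    is replaced by its residue modulo \<open>l\<close>.\<close>
  define b where "b = nat (a mod int l)"
  have b: "int b = a mod int l" using l by (simp add: b_def)
  have "(a ^ l - a) mod int l = (int b ^ l - int b) mod int l"
    unfolding b by (intro mod_diff_cong) (simp_all add: power_mod)
  then show ?thesis
    using nat[of b] by (simp add: dvd_eq_mod_eq_0)
qed

text \<open>Modulo \<open>l\<close>, taking \<open>l\<close>-th powers is additive and fixes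
  integers, so it acts on a polynomial only by replacing x by x^l.\<close>

lemma dvd_power_diff_pcompose:
  fixes f :: "int poly"
  assumes "prime l"
  shows "of_nat l dvd f ^ l - f \<circ>\<^sub>p monom 1 l"
proof (induction f)
  case 0
  then show ?case using prime_gt_0_nat[OF assms] by (simp add: power_0_left)
next
  case (pCons a f)
  have eq: "pCons a f = [:a:] + monom 1 1 * f"
    by (simp add: monom_altdef)
  have 1: "of_nat l dvd pCons a f ^ l - ([:a:] ^ l + (monom 1 1 * f) ^ l)"
    unfolding eq by (rule dvd_freshman[OF assms])
  obtain c where c: "a ^ l - a = int l * c"
    using int_prime_dvd_power_diff[OF assms, of a] by auto
  have "[:a:] ^ l - [:a:] = of_nat l * [:c:]"
    using c by (simp add: poly_const_pow of_nat_poly)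
  then have 2: "of_nat l dvd [:a:] ^ l - [:a:]" by (rule dvdI)
  have 3: "of_nat l dvd monom 1 l * (f ^ l - f \<circ>\<^sub>p monom 1 l)"
    using pCons.IH by simp
  have "pCons a f ^ l - pCons a f \<circ>\<^sub>p monom 1 l =
      (pCons a f ^ l - ([:a:] ^ l + (monom 1 1 * f) ^ l)) + ([:a:] ^ l - [:a:])
      + monom 1 l * (f ^ l - f \<circ>\<^sub>p monom 1 l)"
    by (simp add: pcompose_pCons algebra_simps power_mult_distrib monom_power)
  with 1 2 3 show ?case by (metis dvd_add)
qed

text \<open>Write \<open>x\<^sup>n - 1 = f g\<close>. If \<open>\<zeta>\<^sup>l\<close> were a root of \<open>g\<close>, then \<open>g(\<zeta>)\<^sup>l \<in> l\<int>[\<zeta>]\<close>, and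
  \<open>f'(\<zeta>) g(\<zeta>) = n \<zeta>\<^sup>n\<^sup>-\<^sup>1\<close> would give \<open>n\<^sup>l \<in> l\<int>[\<zeta>] \<inter> \<int> = l\<int>\<close>.\<close>

lemma root_power_prime:
  fixes f :: "int poly"
  assumes "prime l" "n > 0" "\<not> l dvd n" "f dvd xpow_minus_one n" "poly (cpoly f) \<zeta> = 0"
  shows "poly (cpoly f) (\<zeta> ^ l) = 0"
proof (rule ccontr)
  assume nz: "poly (cpoly f) (\<zeta> ^ l) \<noteq> 0"
  from assms(4) obtain g where "xpow_minus_one n = f * g" ..
  then have fg: "cpoly f * cpoly g = monom 1 n - 1"
    by (metis cpoly_mult cpoly_xpow)
  have ev: "poly (cpoly f) z * poly (cpoly g) z = z ^ n - 1" for z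
    using arg_cong[OF fg, of "\<lambda>p. poly p z"] by (simp add: poly_monom)
  have \<zeta>n: "\<zeta> ^ n = 1"
    using ev[of \<zeta>] assms(5) by simp
  have "(\<zeta> ^ l) ^ n = 1"
    using \<zeta>n by (metis mult.commute power_mult power_one)
  then have g0: "poly (cpoly g) (\<zeta> ^ l) = 0"
    using ev[of "\<zeta> ^ l"] nz by simp
  obtain W where W: "g ^ l - g \<circ>\<^sub>p monom 1 l = of_nat l * W"
    using dvd_power_diff_pcompose[OF assms(1), of g] ..
  have "poly (cpoly g) \<zeta> ^ l = of_nat l * poly (cpoly W) \<zeta>"
    using arg_cong[OF W, of "\<lambda>p. poly (cpoly p) \<zeta>"] g0
    by (simp add: cpoly_diff cpoly_mult cpoly_power cpoly_of_nat poly_cpoly_pcompose_monom)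
  moreover have "poly (pderiv (cpoly f)) \<zeta> * poly (cpoly g) \<zeta> = of_nat n * \<zeta> ^ (n - 1)"
    using arg_cong[OF fg, of "\<lambda>p. poly (pderiv p) \<zeta>"] assms(5)
    by (simp add: pderiv_mult pderiv_diff pderiv_monom poly_monom mult.commute)
  \<comment> \<open>One more factor \<zeta> removes the unit \<open>\<zeta> ^ (n - 1)\<close>; its
    \<open>l\<close>-th power is the factor \<open>monom 1 l\<close> below.\<close>
  moreover have "\<zeta> ^ (n - 1) * \<zeta> = 1"
    using \<zeta>n assms(2) by (metis power_minus_mult)
  ultimately have "(of_nat n) ^ l = of_nat l * poly (cpoly (W * pderiv f ^ l * monom 1 l)) \<zeta>"
    by (simp add: cpoly_mult cpoly_power cpoly_pderiv map_poly_monom poly_monom)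
       (metis (no_types, lifting) mult.assoc mult.commute mult.right_neutral power_mult_distrib)
  then have "int l dvd int n ^ l"
    by (intro dvd_of_root_of_unity_eval[OF assms(1,2) \<zeta>n, of _ "W * pderiv f ^ l * monom 1 l"])
      simp
  then have "l dvd n ^ l"
    by (metis of_nat_dvd_iff of_nat_power)
  then have "l dvd n"
    using assms(1) prime_dvd_power by blast
  with assms(3) show False ..
qed

text \<open>The prime factors of \<open>k\<close> are applied one at a time; \<zeta> stays arbitrary
  because after a factor \<open>l\<close> the root is \<open>\<zeta> ^ l\<close>.\<close>

lemma root_power_coprime:
  fixes f :: "int poly"
  assumes "n > 0" "f dvd xpow_minus_one n" "poly (cpoly f) \<zeta> = 0" "coprime k n" "k > 0"
  shows "poly (cpoly f) (\<zeta> ^ k) = 0"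
  using assms(5,4,3)
proof (induction k arbitrary: \<zeta> rule: prime_divisors_induct)
  case (factor l k)
  then have "\<not> l dvd n"
    by (metis coprime_common_divisor coprime_mult_left_iff dvd_refl not_prime_unit)
  then have "poly (cpoly f) (\<zeta> ^ l) = 0"
    using factor assms by (intro root_power_prime[of l n]) auto
  then show ?case
    using factor by (simp add: power_mult)
qed auto

subsection \<open>Semigroup polynomials\<close>

text \<open>The quotient of x^m - 1 by x - 1, polymorphic so that the same identities can be read
  over the integers and over the complex numbers.\<close>

definition geo :: "nat \<Rightarrow> 'a :: comm_ring_1 poly" where
  "geo m = (\<Sum>i<m. monom 1 i)"

lemma geo_mult: "(monom 1 1 - 1) * geo m = monom 1 m - 1"
  by (induction m) (simp_all add: geo_def algebra_simps mult_monom)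

lemma poly_geo_1: "poly (geo m) 1 = of_nat m"
  by (simp add: geo_def poly_sum poly_monom)

lemma coeff_geo: "coeff (geo m) i = of_bool (i < m)"
  by (simp add: geo_def coeff_sum)

lemma cpoly_geo: "cpoly (geo m) = geo m"
  by (rule poly_eqI) (simp add: coeff_map_poly coeff_geo)

text \<open>The series of \<open>S\<close> is 1/(1 - x) minus the finite sum over the gaps. This
  supplies the existence and uniqueness behind the \<open>THE\<close> in
  \<open>semigroup_poly\<close>.\<close>

lemma semigroup_poly_eq:
  assumes "numerical_semigroup S"
  shows "semigroup_poly S = 1 + [:-1, 1:] * (\<Sum>g\<in>UNIV - S. monom 1 g)"
    and "fps_of_poly (semigroup_poly S) = (1 - fps_X) * semigroup_fps S"
proof -
  let ?Q = "1 + [:-1, 1:] * (\<Sum>g\<in>UNIV - S. monom 1 g) :: int poly"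
  have fin: "finite (UNIV - S)" and "0 \<in> S"
    using assms by (simp_all add: numerical_semigroup_def)
  have c: "coeff (\<Sum>g\<in>UNIV - S. monom 1 g) n = (of_bool (n \<notin> S) :: int)" for n
    using fin by (simp add: coeff_sum)
  have Q: "fps_of_poly ?Q = (1 - fps_X) * semigroup_fps S"
  proof (rule fps_ext)
    fix n
    show "fps_nth (fps_of_poly ?Q) n = fps_nth ((1 - fps_X) * semigroup_fps S) n"
      using \<open>0 \<in> S\<close>
      by (cases n) (auto simp: c semigroup_fps_def left_diff_distrib coeff_pCons)
  qed
  moreover have "p = ?Q" if "fps_of_poly p = (1 - fps_X) * semigroup_fps S" for p
    using that Q by (metis fps_of_poly_eq_iff)
  ultimately show "semigroup_poly S = ?Q"
    unfolding semigroup_poly_def by (rule the_equality)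
  with Q show "fps_of_poly (semigroup_poly S) = (1 - fps_X) * semigroup_fps S"
    by simp
qed

lemma coeff_semigroup_poly:
  assumes "numerical_semigroup S"
  shows "coeff (semigroup_poly S) n = of_bool (n \<in> S) - of_bool (n > 0 \<and> n - 1 \<in> S)"
  unfolding fps_of_poly_nth[symmetric] semigroup_poly_eq(2)[OF assms]
  by (simp add: semigroup_fps_def left_diff_distrib)

lemma poly_semigroup_poly_1:
  assumes "numerical_semigroup S"
  shows "poly (semigroup_poly S) 1 = 1"
  by (simp add: semigroup_poly_eq(1)[OF assms])

text \<open>With \<open>H\<close> the generating function of \<open>S\<close>, the hypothesis says
  \<open>H (1 - x\<^sup>b) = \<Sum>i<b. x\<^sup>a\<^sup>i\<close>; comparing coefficients gives a recursion for membership in \<open>S\<close>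
  that \<open>gen2 a b\<close> satisfies as well.\<close>

lemma eq_gen2I:
  assumes "numerical_semigroup S" "a > 0" "b > 0"
    and "semigroup_poly S * geo a * geo b = geo (a * b)"
  shows "S = gen2 a b"
proof -
  let ?H = "semigroup_fps S" and ?X = "fps_X :: int fps"
  have fgeo: "(1 - ?X) * fps_of_poly (geo m) = 1 - ?X ^ m" for m
    using arg_cong[OF geo_mult[of m, where ?'a = int], of fps_of_poly]
    by (simp add: fps_of_poly_mult fps_of_poly_diff fps_of_poly_monom algebra_simps)
  have "(1 - ?X) * (?H * fps_of_poly (geo a) * fps_of_poly (geo b)) = fps_of_poly (geo (a * b))"
    using arg_cong[OF assms(4), of fps_of_poly]
    by (simp add: fps_of_poly_mult semigroup_poly_eq(2)[OF assms(1)] mult_ac)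
  \<comment> \<open>The second factor 1 - x completes both \<open>geo\<close> factors to 1 - x^a and
    1 - x^b; the right side then splits off 1 - x^a, which cancels.\<close>
  then have "(1 - ?X) * ((1 - ?X) * (?H * fps_of_poly (geo a) * fps_of_poly (geo b))) = 1 - ?X ^ (a * b)"
    using fgeo[of "a * b"] by simp
  then have "((1 - ?X) * fps_of_poly (geo a)) * (?H * ((1 - ?X) * fps_of_poly (geo b))) = 1 - ?X ^ (a * b)"
    by (simp only: mult_ac)
  then have "(1 - ?X ^ a) * (?H * (1 - ?X ^ b)) = (1 - ?X ^ a) * (\<Sum>i<b. (?X ^ a) ^ i)"
    by (simp only: fgeo one_diff_power_eq[symmetric] power_mult)
  moreover have "1 - ?X ^ a \<noteq> 0"
    using assms(2) by (metis diff_eq_diff_eq eq_iff_diff_eq_0 fps_X_power_nth fps_one_nth less_irrefl zero_neq_one)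
  ultimately have H: "?H * (1 - ?X ^ b) = (\<Sum>i<b. ?X ^ (a * i))"
    by (simp add: power_mult)
  have rec: "of_bool (n \<in> S) - of_bool (n \<ge> b \<and> n - b \<in> S) = (\<Sum>i<b. of_bool (n = a * i) :: int)" for n
    using arg_cong[OF H, of "\<lambda>f. fps_nth f n"]
    by (simp add: semigroup_fps_def right_diff_distrib fps_X_power_mult_right_nth fps_sum_nth of_bool_def
        not_less cong: if_cong split: if_splits)
  \<comment> \<open>In \<open>rec\<close>, a positive right side forces the first indicator to be 1,
    and a zero right side makes the two indicators agree.\<close>
  have step: "n \<in> S \<longleftrightarrow> (\<exists>i<b. n = a * i) \<or> (n \<ge> b \<and> n - b \<in> S)" for n
  proof (cases "\<exists>i<b. n = a * i")
    case True
    then obtain i where "i < b" "n = a * i" by blast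
    then have "(\<Sum>i<b. of_bool (n = a * i) :: int) > 0"
      by (intro sum_pos2[of _ i]) auto
    then have "n \<in> S"
      unfolding rec[of n, symmetric] by (simp split: if_splits)
    with True show ?thesis by simp
  next
    case False
    then have "(\<Sum>i<b. of_bool (n = a * i) :: int) = 0"
      by (intro sum.neutral) auto
    with rec[of n] False show ?thesis by auto
  qed
  have "n \<in> S \<longleftrightarrow> n \<in> gen2 a b" for n
  proof (induction n rule: less_induct)
    case (less n)
    have IH: "n - b \<in> S \<longleftrightarrow> n - b \<in> gen2 a b" if "n \<ge> b"
      using that assms(3) by (intro less) auto
    have "n \<in> gen2 a b \<longleftrightarrow> (\<exists>i<b. n = a * i) \<or> (n \<ge> b \<and> n - b \<in> gen2 a b)"
    proof
      assume "n \<in> gen2 a b"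
      then obtain i j where n: "n = i * a + j * b" by (auto simp: gen2_def)
      show "(\<exists>i<b. n = a * i) \<or> (n \<ge> b \<and> n - b \<in> gen2 a b)"
      proof (cases "i < b \<and> j = 0")
        case True
        with n show ?thesis by (auto simp: mult.commute)
      next
        case False
        then consider j' where "j = Suc j'" | "i \<ge> b" "j = 0"
          by (cases j) auto
        then show ?thesis
        proof cases
          case 1
          then have "n = b + (i * a + j' * b)" using n by simp
          then show ?thesis by (auto simp: gen2_def)
        next
          case 2
          \<comment> \<open>Of the \<open>i\<close> copies of \<open>a\<close>, \<open>b\<close> are
            traded for \<open>a\<close> copies of \<open>b\<close>, and one of these is split
            off.\<close>
          obtain k c where "i = b + k" "a = Suc c"
            using 2 assms(2) by (metis le_Suc_ex gr0_implies_Suc)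
          then have "n = b + (k * a + c * b)" using n 2 by (simp add: algebra_simps)
          then show ?thesis by (auto simp: gen2_def)
        qed
      qed
    next
      assume "(\<exists>i<b. n = a * i) \<or> (n \<ge> b \<and> n - b \<in> gen2 a b)"
      then show "n \<in> gen2 a b"
      proof (elim disjE exE conjE)
        fix i assume "n = a * i"
        then have "n = i * a + 0 * b" by simp
        then show ?thesis unfolding gen2_def by blast
      next
        assume "n \<ge> b" "n - b \<in> gen2 a b"
        then obtain i j where "n - b = i * a + j * b" by (auto simp: gen2_def)
        with \<open>n \<ge> b\<close> have "n = i * a + Suc j * b" by simp
        then show ?thesis unfolding gen2_def by blast
      qed
    qed
    with step[of n] IH show ?case by blast
  qed
  then show ?thesis by blast
qed

subsection \<open>Cyclotomic polynomials over the complex numbers\<close>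

text \<open>For \<open>d = 0\<close> both conditions hold of every \<open>z\<close>, hence the
  positivity assumptions below.\<close>

definition primitive_roots :: "nat \<Rightarrow> complex set" where
  "primitive_roots d = {z. z ^ d = 1 \<and> (\<forall>e. 0 < e \<and> e < d \<longrightarrow> z ^ e \<noteq> 1)}"

text \<open>For \<open>d > 0\<close> the cyclotomic polynomial, given by its complex roots; integer
  polynomials are therefore compared with it through \<open>cpoly\<close>.\<close>

definition cyc :: "nat \<Rightarrow> complex poly" where
  "cyc d = (\<Prod>z\<in>primitive_roots d. [:-z, 1:])"

lemma primitive_roots_power_eq_1_iff:
  assumes "z \<in> primitive_roots d" "d > 0"
  shows "z ^ m = 1 \<longleftrightarrow> d dvd m"
proof -
  have "z ^ m = z ^ (d * (m div d) + m mod d)" by simp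
  also have "\<dots> = z ^ (m mod d)"
    using assms(1) unfolding power_add power_mult by (simp add: primitive_roots_def)
  finally have "z ^ m = z ^ (m mod d)" .
  moreover have "z ^ (m mod d) = 1 \<longleftrightarrow> m mod d = 0"
    using assms mod_less_divisor[of d m] by (auto simp: primitive_roots_def)
  ultimately show ?thesis
    by (simp add: dvd_eq_mod_eq_0)
qed

lemma ex_primitive_order:
  fixes z :: complex
  assumes "z ^ n = 1" "n > 0"
  obtains d where "d > 0" "d dvd n" "z \<in> primitive_roots d"
proof -
  define d where "d = (LEAST d. d > 0 \<and> z ^ d = 1)"
  have d: "d > 0" "z ^ d = 1"
    using LeastI[of "\<lambda>d. d > 0 \<and> z ^ d = 1" n] assms by (auto simp: d_def)
  moreover have "z \<in> primitive_roots d"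
    using d not_less_Least[of _ "\<lambda>d. d > 0 \<and> z ^ d = 1"]
    by (auto simp: primitive_roots_def d_def)
  ultimately show ?thesis
    using that assms primitive_roots_power_eq_1_iff by blast
qed

lemma roots_of_unity_eq_Union:
  assumes "n > 0"
  shows "{z::complex. z ^ n = 1} = (\<Union>d\<in>{d. d dvd n}. primitive_roots d)"
proof (intro equalityI subsetI)
  fix z assume "z \<in> {z::complex. z ^ n = 1}"
  then show "z \<in> (\<Union>d\<in>{d. d dvd n}. primitive_roots d)"
    using ex_primitive_order[of z n] assms by blast
next
  fix z assume "z \<in> (\<Union>d\<in>{d. d dvd n}. primitive_roots d)"
  then obtain d where "d dvd n" "z \<in> primitive_roots d" by blast
  then show "z \<in> {z::complex. z ^ n = 1}"
    using primitive_roots_power_eq_1_iff[of z d n] assms dvd_pos_nat by auto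
qed

lemma primitive_roots_disjoint:
  assumes "d > 0" "e > 0" "d \<noteq> e"
  shows "primitive_roots d \<inter> primitive_roots e = {}"
  using assms primitive_roots_power_eq_1_iff dvd_antisym by (metis disjoint_iff dvd_refl)

lemma finite_unity_roots: "n > 0 \<Longrightarrow> finite {z::complex. z ^ n = 1}"
  by (rule finite_subset[OF _ poly_roots_finite[of "monom 1 n - 1"]])
     (auto simp: poly_monom monom_eq_1_iff)

lemma finite_primitive_roots: "d > 0 \<Longrightarrow> finite (primitive_roots d)"
  by (rule finite_subset[OF _ finite_unity_roots[of d]]) (auto simp: primitive_roots_def)

lemma prod_cyc:
  assumes "D \<subseteq> {0<..}" "finite D"
  shows "(\<Prod>z\<in>(\<Union>d\<in>D. primitive_roots d). [:-z, 1:]) = (\<Prod>d\<in>D. cyc d)"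
  unfolding cyc_def
  by (rule prod.UNION_disjoint)
     (use assms finite_primitive_roots primitive_roots_disjoint in \<open>auto simp: subset_iff\<close>)

lemma degree_monom_minus_1:
  "n > 0 \<Longrightarrow> degree (monom 1 n - 1 :: complex poly) = n"
  using degree_add_eq_left[of "- 1" "monom 1 n :: complex poly"] by (simp add: degree_monom_eq)

lemma rsquarefree_monom_minus_1:
  assumes "n > 0"
  shows "rsquarefree (monom 1 n - 1 :: complex poly)"
  unfolding rsquarefree_roots
  using assms by (auto simp: poly_monom pderiv_diff pderiv_monom power_0_left)

text \<open>A monic squarefree polynomial is the product over its roots; here the roots are grouped
  by their order.\<close>

lemma prod_cyc_divisors:
  assumes "n > 0"
  shows "(\<Prod>d\<in>{d. d dvd n}. cyc d) = monom 1 n - 1"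
proof -
  have "lead_coeff (monom 1 n - 1 :: complex poly) = 1"
    using assms by (simp add: degree_monom_minus_1)
  then have "monom 1 n - 1 = (\<Prod>z|z ^ n = 1. [:-z :: complex, 1:])"
    using complex_poly_decompose_rsquarefree[OF rsquarefree_monom_minus_1[OF assms]]
    by (simp add: poly_monom)
  also have "\<dots> = (\<Prod>d\<in>{d. d dvd n}. cyc d)"
    unfolding roots_of_unity_eq_Union[OF assms]
    by (rule prod_cyc) (use assms dvd_pos_nat in \<open>auto simp: finite_divisors_nat\<close>)
  finally show ?thesis ..
qed

section \<open>Primitive roots as coprime powers of one another\<close>

lemma primitive_roots_power:
  assumes "z \<in> primitive_roots d" "w \<in> primitive_roots d" "d > 0"
  obtains k where "k > 0" "coprime k d" "w = z ^ k"
proof -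
  \<comment> \<open>Exponents start at 1 to make \<open>k\<close> positive. These \<open>d\<close>
    distinct powers exhaust the at most \<open>d\<close> roots of x^d - 1.\<close>
  have inj: "inj_on (\<lambda>i. z ^ i) {1..d}"
  proof (rule linorder_inj_onI)
    fix i j assume ij: "i < j" "i \<in> {1..d}" "j \<in> {1..d}"
    have "z \<noteq> 0"
      using assms(1,3) by (auto simp: primitive_roots_def power_0_left)
    moreover have "z ^ j = z ^ i * z ^ (j - i)"
      using ij(1) by (simp flip: power_add)
    moreover have "z ^ (j - i) \<noteq> 1"
      using ij assms(1) by (auto simp: primitive_roots_def)
    ultimately show "z ^ i \<noteq> z ^ j" by simp
  qed auto
  let ?R = "{x::complex. x ^ d = 1}"
  have "z ^ d = 1" "w ^ d = 1" using assms by (auto simp: primitive_roots_def)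
  have "(z ^ i) ^ d = 1" for i
    using \<open>z ^ d = 1\<close> by (metis mult.commute power_mult power_one)
  then have sub: "(\<lambda>i. z ^ i) ` {1..d} \<subseteq> ?R"
    by blast
  have "card ?R \<le> d"
    using card_poly_roots_bound[of "monom 1 d - 1 :: complex poly"] assms(3)
    by (auto simp: degree_monom_minus_1 poly_monom monom_eq_1_iff)
  then have "(\<lambda>i. z ^ i) ` {1..d} = ?R"
    using inj sub finite_unity_roots[OF assms(3)]
    by (intro card_subset_eq antisym[OF card_mono]) (simp_all only: card_image card_atLeastAtMost diff_Suc_1)
  with \<open>w ^ d = 1\<close> obtain k where k: "k \<in> {1..d}" "w = z ^ k" by blast
  \<comment> \<open>A common divisor \<open>g\<close> makes \<open>w\<close> to the power
    \<open>d / g\<close> equal to 1, and since \<open>w\<close> has order \<open>d\<close> this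
    forces \<open>g = 1\<close>.\<close>
  have "coprime k d"
  proof (rule coprimeI)
    fix g assume g: "g dvd k" "g dvd d"
    then obtain e f where ef: "d = g * e" "k = g * f" by blast
    have "w ^ e = (z ^ d) ^ f"
      unfolding k(2) ef power_mult[symmetric] by (simp only: mult_ac)
    then have "w ^ e = 1" using \<open>z ^ d = 1\<close> by simp
    then have "d dvd e" using primitive_roots_power_eq_1_iff[OF assms(2,3)] by blast
    moreover have "e > 0" using ef(1) assms(3) by (cases e) auto
    ultimately have "g * e \<le> 1 * e"
      using dvd_imp_le[of d e] unfolding ef(1) by (simp only: mult_1)
    then have "g \<le> 1"
      using \<open>e > 0\<close> by (simp only: mult_le_cancel2)
    moreover have "g \<noteq> 0"
      using ef(1) assms(3) by (cases g) auto
    ultimately have "g = 1" by linarith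
    then show "is_unit g" by (simp only: one_dvd)
  qed
  with k(1) show ?thesis by (intro that[OF _ _ k(2)]) auto
qed

text \<open>Take for \<open>t\<close> the product of the primes of \<open>n\<close> not dividing
  \<open>k\<close>. Every prime of \<open>n\<close> then divides exactly one of \<open>k\<close> and
  \<open>d * t\<close>.\<close>

lemma ex_coprime_shift:
  fixes k d n :: nat
  assumes "coprime k d" "n > 0"
  obtains t where "coprime (k + d * t) n"
proof
  let ?P = "{s \<in> prime_factors n. \<not> s dvd k}"
  show "coprime (k + d * (\<Prod>?P)) n"
  proof (rule ccontr)
    assume "\<not> coprime (k + d * (\<Prod>?P)) n"
    then have "gcd (k + d * (\<Prod>?P)) n \<noteq> 1"
      by (simp add: coprime_iff_gcd_eq_1)
    then obtain s where "prime s" "s dvd gcd (k + d * (\<Prod>?P)) n"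
      using prime_factor_nat by blast
    then have s: "prime s" "s dvd k + d * (\<Prod>?P)" "s dvd n"
      by simp_all
    show False
    proof (cases "s dvd k")
      case True
      then have "s dvd d * (\<Prod>?P)" using s(2) dvd_add_right_iff by blast
      then consider "s dvd d" | "s dvd \<Prod>?P" using s(1) prime_dvd_mult_iff by blast
      then show False
      proof cases
        case 1
        with True assms(1) s(1) show False
          by (metis coprime_common_divisor not_prime_unit)
      next
        case 2
        then obtain u where "u \<in> ?P" "s dvd u"
          using s(1) prime_dvd_prod_iff[of ?P s id] by auto
        with s(1) True show False
          by (auto dest: primes_dvd_imp_eq)
      qed
    next
      case False
      then have "s \<in> ?P" using s assms(2) by (auto simp: prime_factors_dvd)
      then have "s dvd \<Prod>?P" by (intro dvd_prodI[of ?P s id, simplified]) auto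
      then have "s dvd k" using s(2) by (meson dvd_add_left_iff dvd_mult)
      with False show False ..
    qed
  qed
qed

text \<open>The exponent leading from \<open>z\<close> to \<open>w\<close> is coprime only to
  \<open>d\<close>; a multiple of \<open>d\<close> is added, without changing the power of
  \<open>z\<close>, to make it coprime to \<open>n\<close>.\<close>

lemma primitive_roots_subset_roots:
  fixes f :: "int poly"
  assumes "n > 0" "f dvd xpow_minus_one n" "d dvd n" "z \<in> primitive_roots d" "poly (cpoly f) z = 0"
  shows "primitive_roots d \<subseteq> {z. poly (cpoly f) z = 0}"
proof
  fix w assume w: "w \<in> primitive_roots d"
  have d: "d > 0" using assms(1,3) by (rule dvd_pos_nat)
  obtain k where k: "k > 0" "coprime k d" "w = z ^ k"
    using primitive_roots_power[OF assms(4) w d] .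
  obtain t where t: "coprime (k + d * t) n"
    using ex_coprime_shift[OF k(2) assms(1)] .
  have "z ^ (k + d * t) = w"
    using assms(4) k by (simp add: power_add power_mult primitive_roots_def)
  moreover have "poly (cpoly f) (z ^ (k + d * t)) = 0"
    using assms t k by (intro root_power_coprime[of n]) auto
  ultimately show "w \<in> {z. poly (cpoly f) z = 0}" by simp
qed

text \<open>The roots form a union of full sets \<open>primitive_roots d\<close>, and they are
  simple, as a double root of \<open>f\<close> would be one of x^n - 1.\<close>

lemma cyclotomic_factorization:
  fixes f :: "int poly"
  assumes "n > 0" "f dvd xpow_minus_one n"
  obtains c D where "D \<subseteq> {d. d dvd n}" "cpoly f = smult c (\<Prod>d\<in>D. cyc d)"
proof -
  define A where "A = {z. poly (cpoly f) z = 0}"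
  define D where "D = {d. d dvd n \<and> primitive_roots d \<subseteq> A}"
  obtain g where "xpow_minus_one n = f * g" using assms(2) ..
  then have fg: "cpoly f * cpoly g = monom 1 n - 1"
    by (metis cpoly_mult cpoly_xpow)
  have "rsquarefree (cpoly f)"
    unfolding rsquarefree_roots
  proof (intro allI notI, elim conjE)
    fix a assume "poly (cpoly f) a = 0" "poly (pderiv (cpoly f)) a = 0"
    then have "poly (monom 1 n - 1) a = 0 \<and> poly (pderiv (monom 1 n - 1)) a = 0"
      unfolding fg[symmetric] by (simp add: pderiv_mult)
    then show False
      using rsquarefree_monom_minus_1[OF assms(1)] unfolding rsquarefree_roots by blast
  qed
  then obtain c where "cpoly f = smult c (\<Prod>z\<in>A. [:-z, 1:])"
    using complex_poly_decompose_rsquarefree unfolding A_def by metis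
  moreover have "A = (\<Union>d\<in>D. primitive_roots d)"
  proof (intro equalityI subsetI)
    fix z assume z: "z \<in> A"
    then have "z ^ n = 1"
      using arg_cong[OF fg, of "\<lambda>p. poly p z"] by (simp add: poly_monom A_def)
    then obtain d where "d dvd n" "z \<in> primitive_roots d"
      using ex_primitive_order assms(1) by metis
    with z show "z \<in> (\<Union>d\<in>D. primitive_roots d)"
      using primitive_roots_subset_roots[OF assms] unfolding D_def A_def by blast
  qed (auto simp: D_def)
  moreover have "(\<Prod>z\<in>(\<Union>d\<in>D. primitive_roots d). [:-z, 1:]) = (\<Prod>d\<in>D. cyc d)"
    by (rule prod_cyc) (use assms(1) dvd_pos_nat in \<open>auto simp: D_def finite_divisors_nat\<close>)
  ultimately have "cpoly f = smult c (\<Prod>d\<in>D. cyc d)"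
    by (simp only:)
  then show ?thesis
    by (intro that[of D]) (auto simp: D_def)
qed

subsection \<open>Three primes\<close>

lemma divisors_mult:
  fixes a b :: nat
  shows "{d. d dvd a * b} = (\<lambda>(x, y). x * y) ` ({d. d dvd a} \<times> {d. d dvd b})"
proof (intro equalityI subsetI)
  fix d assume "d \<in> {d. d dvd a * b}"
  then obtain x y where "d = x * y" "x dvd a" "y dvd b"
    using division_decomp[of d a b] by blast
  then show "d \<in> (\<lambda>(x, y). x * y) ` ({d. d dvd a} \<times> {d. d dvd b})"
    by (intro image_eqI[of _ _ "(x, y)"]) simp_all
next
  fix d assume "d \<in> (\<lambda>(x, y). x * y) ` ({d. d dvd a} \<times> {d. d dvd b})"
  then show "d \<in> {d. d dvd a * b}"
    by (auto intro: mult_dvd_mono)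
qed

lemma divisors_prime: "prime (p::nat) \<Longrightarrow> {d. d dvd p} = {1, p}"
  by (auto simp: prime_nat_iff)

text \<open>Allows a product over the divisor set to be written out as eight separate
  factors.\<close>

lemma distinct_divisors:
  fixes p q r :: nat
  assumes "prime p" "prime q" "prime r" "p \<noteq> q" "q \<noteq> r" "p \<noteq> r"
  shows "distinct [1, p, q, r, p * q, p * r, q * r, p * q * r]"
proof -
  have ge: "p > 1" "q > 1" "r > 1" using assms prime_gt_1_nat by auto
  have np: "x * y \<noteq> s" if "prime s" "x > 1" "y > 1" for x y s :: nat
    using that prime_product by (metis less_irrefl)
  have "q * r \<noteq> p * q" using assms ge by (metis mult.commute mult_cancel1 not_one_less_zero)
  moreover have "p * (q * r) \<noteq> q * r" "p * (q * r) \<noteq> p * r" "p * (q * r) \<noteq> p * q"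
    using ge by auto
  moreover have "p * q * r \<noteq> x" if "prime x" for x
    using ge that np[of x "p * q" r] by (simp add: one_less_mult)
  ultimately show ?thesis
    using assms ge np by (auto simp: mult.assoc)
qed

section \<open>Cyclotomic polynomials of products of at most three primes\<close>

lemma cyc_1: "cyc 1 = monom 1 1 - 1"
  using prod_cyc_divisors[of 1] by simp

lemma cyc_1_mult_geo: "cyc 1 * geo m = monom 1 m - 1"
  unfolding cyc_1 by (rule geo_mult)

lemma cyc_1_nonzero: "cyc 1 \<noteq> 0"
  unfolding cyc_1 by (simp add: monom_eq_1_iff)

lemma cyc_prime:
  assumes "prime p"
  shows "cyc p = geo p"
proof -
  have "cyc 1 * cyc p = monom 1 p - 1"
    using prod_cyc_divisors[of p] assms prime_gt_1_nat[OF assms] by (simp add: divisors_prime)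
  then have "cyc 1 * cyc p = cyc 1 * geo p"
    by (simp only: cyc_1_mult_geo)
  then show ?thesis
    using cyc_1_nonzero mult_left_cancel by blast
qed

text \<open>The factorization of x^(pq) - 1 over the four divisors, with x - 1 cancelled and no
  division left.\<close>

lemma cyc_two_primes:
  assumes "prime p" "prime q" "p \<noteq> q"
  shows "cyc (p * q) * geo p * geo q = geo (p * q)"
proof -
  have gt: "p > 1" "q > 1" using assms prime_gt_1_nat by auto
  have "{d. d dvd p * q} = {1, p, q, p * q}"
    by (auto simp: divisors_mult divisors_prime assms)
  then have "(\<Prod>d\<in>{1, p, q, p * q}. cyc d) = monom 1 (p * q) - 1"
    using prod_cyc_divisors[of "p * q"] gt by simp
  then have "(\<Prod>d\<leftarrow>[1, p, q, p * q]. cyc d) = monom 1 (p * q) - 1"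
    using prod.distinct_set_conv_list[of "[1, p, q, p * q]" cyc] gt assms(3) by simp
  then have "cyc 1 * (cyc (p * q) * geo p * geo q) = cyc 1 * geo (p * q)"
    using assms by (simp add: cyc_prime cyc_1_mult_geo mult_ac del: One_nat_def)
  then show ?thesis
    using cyc_1_nonzero mult_left_cancel by blast
qed

lemma divisors_three_primes:
  fixes p q r :: nat
  assumes "prime p" "prime q" "prime r"
  shows "{d. d dvd p * q * r} = {1, p, q, r, p * q, p * r, q * r, p * q * r}"
  by (auto simp: divisors_mult divisors_prime assms)

lemma cyc_three_primes:
  assumes "prime p" "prime q" "prime r" "p \<noteq> q" "q \<noteq> r" "p \<noteq> r"
  shows "cyc (p * q * r) * cyc (p * q) * cyc (p * r) * cyc (q * r) * geo p * geo q * geo r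
    = geo (p * q * r)"
proof -
  have "p * q * r > 0" using assms prime_gt_0_nat by simp
  from prod_cyc_divisors[OF this]
  have "(\<Prod>d\<leftarrow>[1, p, q, r, p * q, p * r, q * r, p * q * r]. cyc d) = monom 1 (p * q * r) - 1"
    unfolding divisors_three_primes[OF assms(1-3)]
    by (subst prod.distinct_set_conv_list[OF distinct_divisors[OF assms], symmetric]) simp
  then have "cyc 1 * (cyc (p * q * r) * cyc (p * q) * cyc (p * r) * cyc (q * r) * geo p * geo q * geo r)
      = cyc 1 * geo (p * q * r)"
    using assms by (simp add: cyc_prime cyc_1_mult_geo mult_ac del: One_nat_def)
  then show ?thesis
    using cyc_1_nonzero mult_left_cancel by blast
qed

lemma coeff_mult_1:
  "coeff (f * g) 1 = coeff f 0 * coeff g 1 + coeff f 1 * coeff g 0"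
  by (simp add: coeff_mult)

text \<open>Read off from the identity with \<open>geo\<close>. Each \<open>geo m\<close> with
  \<open>m > 1\<close> begins 1 + x, so the linear coefficient c satisfies c + 1 + 1 = 1.\<close>

lemma cyc_two_primes_values:
  assumes "prime p" "prime q" "p \<noteq> q"
  shows "poly (cyc (p * q)) 1 = 1" "coeff (cyc (p * q)) 0 = 1" "coeff (cyc (p * q)) 1 = -1"
proof -
  note eq = cyc_two_primes[OF assms]
  have p: "p > 1" "q > 1" "p * q > 1" using assms prime_gt_1_nat by (auto intro: one_less_mult)
  show "poly (cyc (p * q)) 1 = 1"
    using arg_cong[OF eq, of "\<lambda>f. poly f 1"] p by (simp add: poly_geo_1)
  show 0: "coeff (cyc (p * q)) 0 = 1"
    using arg_cong[OF eq, of "\<lambda>f. coeff f 0"] p by (simp add: coeff_geo coeff_mult_0)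
  show "coeff (cyc (p * q)) 1 = -1"
    using arg_cong[OF eq, of "\<lambda>f. coeff f 1"] p
    by (simp add: coeff_geo coeff_mult_0 coeff_mult_1 0 eq_neg_iff_add_eq_0 algebra_simps del: One_nat_def)
qed

text \<open>Here three factors contribute -1 and three contribute 1 to the linear coefficient, so
  the remaining one must be 1.\<close>

lemma cyc_three_primes_values:
  assumes "prime p" "prime q" "prime r" "p \<noteq> q" "q \<noteq> r" "p \<noteq> r"
  shows "poly (cyc (p * q * r)) 1 = 1" "coeff (cyc (p * q * r)) 0 = 1" "coeff (cyc (p * q * r)) 1 = 1"
proof -
  note eq = cyc_three_primes[OF assms]
  note v = cyc_two_primes_values[OF assms(1,2,4)] cyc_two_primes_values[OF assms(1,3,6)]
    cyc_two_primes_values[OF assms(2,3,5)]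
  have p: "p > 1" "q > 1" "r > 1" "p * q * r > 1"
    using assms prime_gt_1_nat by (auto intro!: one_less_mult)
  show "poly (cyc (p * q * r)) 1 = 1"
    using arg_cong[OF eq, of "\<lambda>f. poly f 1"] p by (simp add: poly_geo_1 v)
  show 0: "coeff (cyc (p * q * r)) 0 = 1"
    using arg_cong[OF eq, of "\<lambda>f. coeff f 0"] p by (simp add: coeff_geo coeff_mult_0 v)
  show "coeff (cyc (p * q * r)) 1 = 1"
    using arg_cong[OF eq, of "\<lambda>f. coeff f 1"] p
    by (simp add: coeff_geo coeff_mult_0 coeff_mult_1 v 0 algebra_simps del: One_nat_def)
qed

section \<open>From cyclotomic factors back to the semigroup\<close>

lemma semigroup_poly_eq_1:
  assumes "numerical_semigroup S" "1 \<in> S"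
  shows "semigroup_poly S = 1"
proof -
  have "n \<in> S" for n
  proof (induction n)
    case (Suc n)
    then have "n + 1 \<in> S"
      using assms unfolding numerical_semigroup_def by blast
    then show ?case by simp
  qed (use assms in \<open>simp add: numerical_semigroup_def\<close>)
  then have "S = UNIV" by blast
  then show ?thesis
    using semigroup_poly_eq(1)[OF assms(1)] by simp
qed

text \<open>The cofactor \<open>geo a * geo b\<close> has integer coefficients, so the complex
  identity descends to a divisibility over the integers.\<close>

lemma dvd_xpow_of_geo:
  assumes "cpoly f * geo a * geo b = geo m"
  shows "f dvd xpow_minus_one m"
proof -
  have "cpoly (f * geo a * geo b) = cpoly (geo m)"
    using assms by (simp add: cpoly_mult cpoly_geo)
  then have "f * (geo a * geo b) = geo m"
    by (simp only: cpoly_eq_iff mult.assoc)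
  moreover have "xpow_minus_one m = (monom 1 1 - 1) * geo m"
    unfolding xpow_minus_one_def geo_mult ..
  ultimately show ?thesis
    by (metis dvd_mult dvd_triv_left)
qed

lemma eq_gen2I_complex:
  assumes "numerical_semigroup S" "a > 0" "b > 0"
    and "cpoly (semigroup_poly S) * geo a * geo b = geo (a * b)"
  shows "S = gen2 a b"
proof (rule eq_gen2I[OF assms(1-3)])
  have "cpoly (semigroup_poly S * geo a * geo b) = cpoly (geo (a * b))"
    using assms(4) by (simp add: cpoly_mult cpoly_geo)
  then show "semigroup_poly S * geo a * geo b = geo (a * b)"
    by (simp only: cpoly_eq_iff)
qed

text \<open>The value 1 at x = 1 excludes \<open>cyc 1\<close>, which vanishes there, and then the
  prime divisors, which would contribute factors \<open>p\<close>, \<open>q\<close>,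
  \<open>r\<close>.\<close>

lemma semigroup_poly_factors:
  fixes p q r :: nat
  assumes pr: "prime p" "prime q" "prime r" "p \<noteq> q" "q \<noteq> r" "p \<noteq> r"
    and S: "numerical_semigroup S"
    and dvd: "semigroup_poly S dvd xpow_minus_one (p * q * r)"
  obtains D where "cpoly (semigroup_poly S) =
    (if p * q \<in> D then cyc (p * q) else 1) * (if p * r \<in> D then cyc (p * r) else 1) *
    (if q * r \<in> D then cyc (q * r) else 1) * (if p * q * r \<in> D then cyc (p * q * r) else 1)"
proof -
  let ?F = "\<lambda>D d. if d \<in> D then cyc d else 1"
  have N: "p * q * r > 0" using pr prime_gt_0_nat by simp
  obtain c D where D: "D \<subseteq> {d. d dvd p * q * r}"
    and f: "cpoly (semigroup_poly S) = smult c (\<Prod>d\<in>D. cyc d)"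
    by (rule cyclotomic_factorization[OF N dvd])
  have "(\<Prod>d\<in>D. cyc d) = (\<Prod>d | d dvd p * q * r. ?F D d)"
    using D N by (simp add: prod.If_cases finite_divisors_nat Int_absorb1)
  also have "\<dots> = (\<Prod>d\<leftarrow>[1, p, q, r, p * q, p * r, q * r, p * q * r]. ?F D d)"
    unfolding divisors_three_primes[OF pr(1-3)]
    by (subst prod.distinct_set_conv_list[OF distinct_divisors[OF pr], symmetric]) simp
  finally have eq: "cpoly (semigroup_poly S) = smult c (?F D 1 * (?F D p * ?F D q * ?F D r *
      (?F D (p * q) * ?F D (p * r) * ?F D (q * r) * ?F D (p * q * r))))"
    by (simp add: f mult_ac)
  note v = cyc_two_primes_values[OF pr(1,2,4)] cyc_two_primes_values[OF pr(1,3,6)]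
    cyc_two_primes_values[OF pr(2,3,5)] cyc_three_primes_values[OF pr]
  have gt: "p > 1" "q > 1" "r > 1" using pr prime_gt_1_nat by auto
  have one: "1 = c * ((if 1 \<in> D then 0 else 1) * ((if p \<in> D then of_nat p else 1) *
      (if q \<in> D then of_nat q else 1) * (if r \<in> D then of_nat r else 1)))"
  proof -
    have "poly (cpoly (semigroup_poly S)) 1 = 1"
      using poly_cpoly_of_int[of "semigroup_poly S" 1] by (simp add: poly_semigroup_poly_1[OF S])
    then show ?thesis
      unfolding eq using pr
      by (simp add: v cyc_prime poly_geo_1 cyc_1 poly_monom if_distrib[of "\<lambda>f. poly f 1"]
          del: One_nat_def cong: if_cong)
  qed
  then have nD: "1 \<notin> D" by auto
  \<comment> \<open>All cyclotomic factors other than \<open>cyc 1\<close> have constant term 1, so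
    the constant term of the product is \<open>c\<close>.\<close>
  have "coeff (cpoly (semigroup_poly S)) 0 = 1"
    using S by (simp add: coeff_map_poly coeff_semigroup_poly numerical_semigroup_def)
  then have c: "c = 1"
    unfolding eq using pr nD gt
    by (simp add: v cyc_prime coeff_geo coeff_mult_0 if_distrib[of "\<lambda>f. coeff f 0"]
        del: One_nat_def cong: if_cong)
  have "of_nat ((if p \<in> D then p else 1) * (if q \<in> D then q else 1) * (if r \<in> D then r else 1))
      = (of_nat 1 :: complex)"
    using one nD c by (simp add: if_distrib[of of_nat] cong: if_cong)
  then have "(if p \<in> D then p else 1) * (if q \<in> D then q else 1) * (if r \<in> D then r else 1) = (1::nat)"
    unfolding of_nat_eq_iff .
  then have "p \<notin> D \<and> q \<notin> D \<and> r \<notin> D"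
    unfolding nat_mult_eq_1_iff using gt by (metis less_irrefl)
  with nD c eq that[of D] show ?thesis by simp
qed

theorem theorem2:
  fixes p q r :: nat and S :: "nat set"
  assumes "prime p" and "prime q" and "prime r"
    and "p \<noteq> q" and "q \<noteq> r" and "p \<noteq> r"
    and "cyclotomic_depth_height S (p * q * r) 1"
  shows "S = gen2 (p * r) q \<or> S = gen2 (q * p) r \<or> S = gen2 (r * q) p"
proof -
  let ?f = "semigroup_poly S"
  note pr = assms(1-6)
  have gt: "p > 1" "q > 1" "r > 1" using pr prime_gt_1_nat by auto
  have S: "numerical_semigroup S" and dvd: "?f dvd xpow_minus_one (p * q * r)"
    and depth: "\<And>d. d dvd p * q * r \<Longrightarrow> d < p * q * r \<Longrightarrow> \<not> ?f dvd xpow_minus_one d"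
    using assms(7) by (auto simp: cyclotomic_depth_height_def cyclotomic_ns_def)
  obtain D where D: "cpoly ?f =
    (if p * q \<in> D then cyc (p * q) else 1) * (if p * r \<in> D then cyc (p * r) else 1) *
    (if q * r \<in> D then cyc (q * r) else 1) * (if p * q * r \<in> D then cyc (p * q * r) else 1)"
    using semigroup_poly_factors[OF pr S dvd] .
  note v = cyc_two_primes_values[OF pr(1,2,4)] cyc_two_primes_values[OF pr(1,3,6)]
    cyc_two_primes_values[OF pr(2,3,5)] cyc_three_primes_values[OF pr]
  note e2 = cyc_two_primes[OF pr(1,2,4)] cyc_two_primes[OF pr(1,3,6)] cyc_two_primes[OF pr(2,3,5)]
  note e3 = cyc_three_primes[OF pr]
  \<comment> \<open>Otherwise the semigroup polynomial is 1 and already divides x - 1, against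
    minimality of the depth.\<close>
  have "1 \<notin> S"
    using depth[of 1] semigroup_poly_eq_1[OF S] gt by (auto simp: one_less_mult)
  then have "coeff (cpoly ?f) 1 = -1"
    using S by (simp add: coeff_map_poly coeff_semigroup_poly numerical_semigroup_def)
  \<comment> \<open>All factors have constant term 1, so the linear coefficient of their product is
    the sum of their linear coefficients.\<close>
  then have sum: "(if p * q \<in> D then -1 else 0) + (if p * r \<in> D then -1 else 0) +
      (if q * r \<in> D then -1 else 0) + (if p * q * r \<in> D then 1 else 0) = (-1 :: complex)"
    unfolding D coeff_mult_1 coeff_mult_0
    by (auto simp: v simp del: One_nat_def split: if_splits)
  \<comment> \<open>The sum equals -1 only for one two-prime factor without
    \<open>cyc (p * q * r)\<close>, or two of them with it.\<close>
  consider "cpoly ?f = cyc (p * q)" | "cpoly ?f = cyc (p * r)" | "cpoly ?f = cyc (q * r)"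
    | "cpoly ?f = cyc (p * q) * cyc (p * r) * cyc (p * q * r)"
    | "cpoly ?f = cyc (p * q) * cyc (q * r) * cyc (p * q * r)"
    | "cpoly ?f = cyc (p * r) * cyc (q * r) * cyc (p * q * r)"
    using that sum unfolding D
    by (cases "p * q \<in> D"; cases "p * r \<in> D"; cases "q * r \<in> D"; cases "p * q * r \<in> D")
      (simp_all only: if_True if_False mult_1_left mult_1_right, simp_all)
  then show ?thesis
  proof cases
    case 1
    then have "?f dvd xpow_minus_one (p * q)"
      using e2(1) by (intro dvd_xpow_of_geo[of _ p q]) simp
    then show ?thesis using depth[of "p * q"] gt by simp
  next
    case 2
    then have "?f dvd xpow_minus_one (p * r)"
      using e2(2) by (intro dvd_xpow_of_geo[of _ p r]) simp
    then show ?thesis using depth[of "p * r"] gt by (simp add: mult_ac)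
  next
    case 3
    then have "?f dvd xpow_minus_one (q * r)"
      using e2(3) by (intro dvd_xpow_of_geo[of _ q r]) simp
    then show ?thesis using depth[of "q * r"] gt by (simp add: mult_ac)
  next
    case 4
    \<comment> \<open>The missing \<open>cyc (q * r)\<close> merges with \<open>geo q\<close> and
      \<open>geo r\<close> into \<open>geo (r * q)\<close>, turning \<open>e3\<close> into the
      criterion for \<open>gen2 (r * q) p\<close>.\<close>
    have "cpoly ?f * geo (r * q) * geo p = geo (r * q * p)"
      using e3 unfolding 4 e2(3)[unfolded mult.commute[of q r], symmetric] by (simp add: mult_ac)
    then show ?thesis using eq_gen2I_complex[OF S, of "r * q" p] gt by simp
  next
    case 5
    have "cpoly ?f * geo (p * r) * geo q = geo (p * r * q)"
      using e3 unfolding 5 e2(2)[symmetric] by (simp add: mult_ac)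
    then show ?thesis using eq_gen2I_complex[OF S, of "p * r" q] gt by simp
  next
    case 6
    have "cpoly ?f * geo (q * p) * geo r = geo (q * p * r)"
      using e3 unfolding 6 e2(1)[unfolded mult.commute[of p q], symmetric] by (simp add: mult_ac)
    then show ?thesis using eq_gen2I_complex[OF S, of "q * p" r] gt by simp
  qed
qed

end
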